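(* Let $d\in\mathbb N$. For every $c>d$ there exists a complex-linear map $\Phi:\mathbb C^{d\times d}\to\mathbb C^{d\times d}$ which is 2-positive and trace-preserving and satisfies $$\mathrm{tr}(\Phi)> c\,\min\Re(\sigma(\Phi))+(d^2-c).$$
   Context: $\mathbb C^{d\times d}$ is the space of complex $d\times d$ matrices, and $c$ is a real number. A linear map $\Phi:\mathbb C^{d\times d}\to\mathbb C^{d\times d}$ is positive if $\Phi(A)$ is positive semi-definite whenever $A$ is positive semi-definite. It is 2-positive if the extended map $\mathrm{id}_2\otimes\Phi:\mathbb C^{2\times 2}\otimes\mathbb C^{d\times d}\to\mathbb C^{2\times 2}\otimes\mathbb C^{d\times d}$, determined by $(\mathrm{id}_2\otimes\Phi)(A\otimes B)=A\otimes\Phi(B)$, is positive (sends positive semi-definite matrices to positive semi-definite matrices). It is trace-preserving if $\mathrm{tr}(\Phi(X))=\mathrm{tr}(X)$ for all $X\in\mathbb C^{d\times d}$. Here $\mathrm{tr}(\Phi)$ is the trace of $\Phi$ as a linear operator on the $d^2$-dimensional complex vector space $\mathbb C^{d\times d}$ (it is a real number for every positive $\Phi$), $\sigma(\Phi)$ is the spectrum of $\Phi$ as such an operator, and $\min\Re(\sigma(\Phi))$ is the smallest real part of any eigenvalue of $\Phi$.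
   Formalization: The formal theorem assumes d ≥ 2: for d = 1 the identity is the only trace-preserving linear map and gives equality for every c, so the strict inequality fails, and for d = 0 the spectrum is empty and its minimum undefined. *)

theory Defs
  imports "HOL-Analysis.Analysis"
begin

text \<open>Complex matrices of size $d \times d$ are elements of \<^typ>\<open>complex^'n^'n\<close> with
  $d$ = \<^term>\<open>CARD('n)\<close>. The library only provides the real vector space structure on this type, so
  the complex one is given explicitly.\<close>

definition cscale :: "complex \<Rightarrow> complex^'n^'m \<Rightarrow> complex^'n^'m" where
  "cscale z A = (\<chi> i j. z * A $ i $ j)"

lemma cscale_nth [simp]: "cscale z A $ i $ j = z * A $ i $ j"
  by (simp add: cscale_def)

lemma vector_space_cscale: "vector_space cscale"
  by unfold_locales (simp_all add: vec_eq_iff algebra_simps)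

definition clinear :: "(complex^'n^'n \<Rightarrow> complex^'n^'n) \<Rightarrow> bool" where
  "clinear \<Phi> \<longleftrightarrow> Vector_Spaces.linear cscale cscale \<Phi>"

lemma clinear_iff:
  "clinear \<Phi> \<longleftrightarrow> (\<forall>A B. \<Phi> (A + B) = \<Phi> A + \<Phi> B) \<and> (\<forall>z A. \<Phi> (cscale z A) = cscale z (\<Phi> A))"
  unfolding clinear_def Vector_Spaces.linear_iff by (simp add: vector_space_cscale)

definition hermitian :: "complex^'n^'n \<Rightarrow> bool" where
  "hermitian A \<longleftrightarrow> (\<forall>i j. A $ i $ j = cnj (A $ j $ i))"

definition psd :: "complex^'n^'n \<Rightarrow> bool" where
  "psd A \<longleftrightarrow> hermitian A \<and> (\<forall>v. (\<Sum>i\<in>UNIV. cnj (v $ i) * (A *v v) $ i) \<in> \<real>\<^sub>\<ge>\<^sub>0)"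

definition positive_map :: "(complex^'n^'n \<Rightarrow> complex^'n^'n) \<Rightarrow> bool" where
  "positive_map \<Phi> \<longleftrightarrow> (\<forall>A. psd A \<longrightarrow> psd (\<Phi> A))"

definition kron :: "complex^'m^'m \<Rightarrow> complex^'n^'n \<Rightarrow> complex^('m::finite \<times> 'n::finite)^('m::finite \<times> 'n::finite)" where
  "kron A B = (\<chi> p q. A $ fst p $ fst q * B $ snd p $ snd q)"

definition block :: "complex^('m::finite \<times> 'n::finite)^('m::finite \<times> 'n::finite) \<Rightarrow> 'm \<Rightarrow> 'm \<Rightarrow> complex^'n^'n" where
  "block X a b = (\<chi> i j. X $ (a, i) $ (b, j))"

text \<open>The map $\mathrm{id} \otimes \Phi$, under the identification of the tensor product of matrix spaces
  with the block matrices given by the Kronecker product: it applies $\Phi$ to every block. The lemmas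
  below show that, for linear $\Phi$, this is the unique linear map sending $A \otimes B$ to
  $A \otimes \Phi(B)$.\<close>

definition id_tensor ::
  "(complex^'n^'n \<Rightarrow> complex^'n^'n) \<Rightarrow> complex^('m::finite \<times> 'n::finite)^('m::finite \<times> 'n::finite) \<Rightarrow> complex^('m::finite \<times> 'n::finite)^('m::finite \<times> 'n::finite)" where
  "id_tensor \<Phi> X = (\<chi> p q. \<Phi> (block X (fst p) (fst q)) $ snd p $ snd q)"

definition two_positive :: "(complex^'n^'n \<Rightarrow> complex^'n^'n) \<Rightarrow> bool" where
  "two_positive \<Phi> \<longleftrightarrow>
     positive_map (id_tensor \<Phi> :: complex^(2 \<times> 'n::finite)^(2 \<times> 'n::finite) \<Rightarrow> complex^(2 \<times> 'n::finite)^(2 \<times> 'n::finite))"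

definition trace_preserving :: "(complex^'n^'n \<Rightarrow> complex^'n^'n) \<Rightarrow> bool" where
  "trace_preserving \<Phi> \<longleftrightarrow> (\<forall>X. trace (\<Phi> X) = trace X)"

definition mat_unit :: "'n \<Rightarrow> 'n \<Rightarrow> complex^'n^'n" where
  "mat_unit k l = (\<chi> i j. if i = k \<and> j = l then 1 else 0)"

text \<open>The representing $d^2 \times d^2$ matrix of $\Phi$ in the basis of matrix units.\<close>

definition op_matrix :: "(complex^'n^'n \<Rightarrow> complex^'n^'n) \<Rightarrow> complex^('n::finite \<times> 'n)^('n \<times> 'n)" where
  "op_matrix \<Phi> = (\<chi> p q. \<Phi> (mat_unit (fst q) (snd q)) $ fst p $ snd p)"

definition op_trace :: "(complex^'n^'n \<Rightarrow> complex^'n^'n) \<Rightarrow> complex" where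
  "op_trace \<Phi> = trace (op_matrix \<Phi>)"

definition op_spectrum :: "(complex^'n^'n \<Rightarrow> complex^'n^'n) \<Rightarrow> complex set" where
  "op_spectrum \<Phi> = {z. \<exists>X. X \<noteq> 0 \<and> \<Phi> X = cscale z X}"

text \<open>For linear maps the spectrum is finite and nonempty, so this minimum is the genuine one.\<close>

definition min_Re_spectrum :: "(complex^'n^'n \<Rightarrow> complex^'n^'n) \<Rightarrow> real" where
  "min_Re_spectrum \<Phi> = Min (Re ` op_spectrum \<Phi>)"

lemma clinear_sum:
  assumes "clinear \<Phi>" shows "\<Phi> (\<Sum>i\<in>I. f i) = (\<Sum>i\<in>I. \<Phi> (f i))"
proof -
  have "\<Phi> 0 = 0" using assms unfolding clinear_iff by (metis add_cancel_left_left)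
  then show ?thesis
    using assms by (induction I rule: infinite_finite_induct) (auto simp: clinear_iff)
qed

lemma mat_unit_expansion: "X = (\<Sum>q\<in>UNIV. cscale (X $ fst q $ snd q) (mat_unit (fst q) (snd q)))"
proof -
  have "(\<Sum>q\<in>UNIV. X $ fst q $ snd q * (if i = fst q \<and> j = snd q then 1 else 0)) = X $ i $ j" for i j
  proof -
    have "(\<Sum>q\<in>UNIV. X $ fst q $ snd q * (if i = fst q \<and> j = snd q then 1 else 0))
        = (\<Sum>q\<in>UNIV. if q = (i, j) then X $ i $ j else 0)"
      by (rule sum.cong) auto
    then show ?thesis by simp
  qed
  then show ?thesis by (simp add: vec_eq_iff mat_unit_def)
qed

lemma op_matrix_represents:
  assumes "clinear \<Phi>"
  shows "\<Phi> X $ i $ j = (op_matrix \<Phi> *v (\<chi> q. X $ fst q $ snd q)) $ (i, j)"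
proof -
  have "\<Phi> X = (\<Sum>q\<in>UNIV. cscale (X $ fst q $ snd q) (\<Phi> (mat_unit (fst q) (snd q))))"
    using assms by (subst mat_unit_expansion) (simp add: clinear_sum clinear_iff)
  then show ?thesis
    by (simp add: op_matrix_def matrix_vector_mult_def mult.commute)
qed

lemma id_tensor_kron:
  assumes "clinear \<Phi>" shows "id_tensor \<Phi> (kron A B) = kron A (\<Phi> B)"
proof -
  have "block (kron A B) a b = cscale (A $ a $ b) B" for a b
    by (simp add: block_def kron_def vec_eq_iff)
  then show ?thesis using assms by (simp add: id_tensor_def kron_def clinear_iff)
qed

lemma clinear_id_tensor:
  fixes \<Phi> :: "complex^'n^'n \<Rightarrow> complex^'n^'n"
  assumes "clinear \<Phi>"
  shows "clinear (id_tensor \<Phi> :: complex^('m::finite \<times> 'n)^('m \<times> 'n) \<Rightarrow> _)"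
proof -
  have "block (X + Y) a b = block X a b + block Y a b"
    "block (cscale z X) a b = cscale z (block X a b)" for X Y :: "complex^('m \<times> 'n)^('m \<times> 'n)" and z a b
    by (simp_all add: block_def vec_eq_iff)
  then have "id_tensor \<Phi> (X + Y) $ p $ q = (id_tensor \<Phi> X + id_tensor \<Phi> Y) $ p $ q"
    "id_tensor \<Phi> (cscale z X) $ p $ q = cscale z (id_tensor \<Phi> X) $ p $ q" for X Y :: "complex^('m \<times> 'n)^('m \<times> 'n)" and z p q
    using assms by (simp_all add: id_tensor_def clinear_iff)
  then show ?thesis unfolding clinear_iff vec_eq_iff by blast
qed

lemma id_tensor_unique:
  fixes \<Phi> :: "complex^'n^'n \<Rightarrow> complex^'n^'n"
    and \<Psi> :: "complex^('m::finite \<times> 'n)^('m \<times> 'n) \<Rightarrow> complex^('m \<times> 'n)^('m \<times> 'n)"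
  assumes "clinear \<Phi>" and "clinear \<Psi>" and "\<And>A B. \<Psi> (kron A B) = kron A (\<Phi> B)"
  shows "\<Psi> = id_tensor \<Phi>"
proof
  fix X
  have unit: "mat_unit p q = kron (mat_unit (fst p) (fst q)) (mat_unit (snd p) (snd q))" for p q
    by (auto simp: mat_unit_def kron_def vec_eq_iff prod_eq_iff)
  have "\<Psi> (mat_unit p q) = id_tensor \<Phi> (mat_unit p q)" for p q
    unfolding unit by (simp add: assms id_tensor_kron)
  then have "\<Psi> (\<Sum>q\<in>UNIV. cscale (X $ fst q $ snd q) (mat_unit (fst q) (snd q)))
    = id_tensor \<Phi> (\<Sum>q\<in>UNIV. cscale (X $ fst q $ snd q) (mat_unit (fst q) (snd q)))"
    using assms(2) clinear_id_tensor[OF assms(1), where 'm = 'm]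
    by (simp only: clinear_sum) (simp only: clinear_iff)
  then show "\<Psi> X = id_tensor \<Phi> X"
    by (simp only: mat_unit_expansion[symmetric])
qed

text \<open>For $d = 1$ the identity is the only trace-preserving linear map, and it gives equality in the
  trace inequality; hence the strict reverse inequality needs $d \ge 2$.\<close>

lemma trace_preserving_dim_one:
  fixes \<Phi> :: "complex^'n^'n \<Rightarrow> complex^'n^'n"
  assumes "CARD('n) = 1" and "trace_preserving \<Phi>"
  shows "Re (op_trace \<Phi>) = c * min_Re_spectrum \<Phi> + ((real CARD('n))\<^sup>2 - c)"
proof -
  obtain a :: 'n where U: "UNIV = {a}" using assms(1) card_1_singletonE by blast
  have all: "x = a" for x :: 'n using U by auto
  have "\<Phi> X = X" for X
  proof -
    have "\<Phi> X $ a $ a = X $ a $ a"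
      using assms(2) by (simp add: trace_preserving_def trace_def U)
    then show ?thesis unfolding vec_eq_iff by (metis all)
  qed
  then have \<Phi>: "\<Phi> = (\<lambda>X. X)" by auto
  have UP: "(UNIV :: ('n \<times> 'n) set) = {(a, a)}" using all by auto
  have tr: "op_trace \<Phi> = 1"
    by (simp add: \<Phi> op_trace_def trace_def op_matrix_def mat_unit_def UP)
  have "op_spectrum \<Phi> = {1}"
  proof -
    have "X = cscale z X \<longleftrightarrow> z = 1" if "X \<noteq> 0" for X :: "complex^'n^'n" and z
      using that unfolding vec_eq_iff by auto
    moreover have "mat_unit a a \<noteq> (0 :: complex^'n^'n)"
      by (auto simp: mat_unit_def vec_eq_iff)
    ultimately show ?thesis unfolding op_spectrum_def \<Phi> by auto
  qed
  then show ?thesis using assms(1) by (simp add: tr min_Re_spectrum_def)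
qed

end

theory Submission
  imports Defs
begin

text \<open>Entrywise (Schur) multiplication by a real Gram matrix $m_{ij} = a_i a_j + b_i b_j$ of unit
  vectors $(a_i, b_i)$ is completely positive and trace-preserving, the $m_{ij}$ are its
  eigenvalues, and its trace is $(\sum_i a_i)^2 + (\sum_i b_i)^2$. Choose all vectors equal to
  $(1, 0)$ except for two, which are $(\cos\theta, \pm\sin\theta)$. The trace is then
  $(d - 2 + 2\cos\theta)^2$ and $\cos 2\theta$ is an eigenvalue, so that the inequality holds for
  small $\theta$; the choice $\cos\theta = d / c$ is small enough.\<close>

definition schur_map :: "('n \<Rightarrow> 'n \<Rightarrow> complex) \<Rightarrow> complex^'n^'n \<Rightarrow> complex^'n^'n" where
  "schur_map m X = (\<chi> i j. m i j * X $ i $ j)"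

lemma schur_map_nth [simp]: "schur_map m X $ i $ j = m i j * X $ i $ j"
  by (simp add: schur_map_def)

lemma clinear_schur_map: "clinear (schur_map m)"
  by (simp add: clinear_iff vec_eq_iff algebra_simps)

lemma trace_preserving_schur_map:
  assumes "\<And>i. m i i = 1"
  shows "trace_preserving (schur_map m)"
  by (simp add: trace_preserving_def trace_def assms)

text \<open>Each \<open>mat_unit i j\<close> is an eigenvector with eigenvalue \<open>m i j\<close>,
  so \<open>op_matrix\<close> is diagonal with the multipliers as its diagonal.\<close>

lemma op_trace_schur_map:
  fixes m :: "'n::finite \<Rightarrow> 'n \<Rightarrow> complex"
  shows "op_trace (schur_map m) = (\<Sum>i\<in>UNIV. \<Sum>j\<in>UNIV. m i j)"
  by (simp add: op_trace_def trace_def op_matrix_def mat_unit_def sum.cartesian_product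
      case_prod_unfold)

text \<open>Matrix units realise every multiplier as an eigenvalue. Conversely, comparing the
  eigenvector equation at a nonzero entry of \<open>X\<close> forces \<open>z\<close> to be the
  multiplier there.\<close>

lemma op_spectrum_schur_map:
  fixes m :: "'n::finite \<Rightarrow> 'n \<Rightarrow> complex"
  shows "op_spectrum (schur_map m) = range (\<lambda>(i, j). m i j)"
proof (intro equalityI subsetI)
  fix z assume "z \<in> op_spectrum (schur_map m)"
  then obtain X where X: "X \<noteq> 0" "schur_map m X = cscale z X"
    by (auto simp: op_spectrum_def)
  then obtain i j where "X $ i $ j \<noteq> 0" by (auto simp: vec_eq_iff)
  moreover from X have "m i j * X $ i $ j = z * X $ i $ j"
    by (metis cscale_nth schur_map_nth)
  ultimately show "z \<in> range (\<lambda>(i, j). m i j)" by auto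
next
  fix z assume "z \<in> range (\<lambda>(i, j). m i j)"
  then obtain i j where z: "z = m i j" by auto
  have "mat_unit i j \<noteq> 0" "schur_map m (mat_unit i j) = cscale z (mat_unit i j)"
    by (auto simp: z mat_unit_def vec_eq_iff)
  then show "z \<in> op_spectrum (schur_map m)" by (auto simp: op_spectrum_def)
qed

text \<open>An upper bound for the minimum is enough later on, because it gets multiplied by a
  positive \<open>c\<close> on the smaller side of the inequality.\<close>

lemma min_Re_spectrum_schur_map_le:
  fixes m :: "'n::finite \<Rightarrow> 'n \<Rightarrow> complex"
  shows "min_Re_spectrum (schur_map m) \<le> Re (m i j)"
  unfolding min_Re_spectrum_def op_spectrum_schur_map by (intro Min_le) force+

lemma psd_add:
  assumes "psd A" "psd B"
  shows "psd (A + B)"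
proof -
  have "hermitian (A + B)"
    unfolding hermitian_def
  proof (intro allI)
    fix i j
    have "A $ i $ j = cnj (A $ j $ i)" "B $ i $ j = cnj (B $ j $ i)"
      using assms unfolding psd_def hermitian_def by blast+
    then show "(A + B) $ i $ j = cnj ((A + B) $ j $ i)" by simp
  qed
  moreover have "(\<Sum>i\<in>UNIV. cnj (v $ i) * ((A + B) *v v) $ i) =
      (\<Sum>i\<in>UNIV. cnj (v $ i) * (A *v v) $ i) + (\<Sum>i\<in>UNIV. cnj (v $ i) * (B *v v) $ i)" for v
    by (simp add: matrix_vector_mult_add_rdistrib distrib_left sum.distrib)
  ultimately show ?thesis
    using assms by (simp only: psd_def nonneg_Reals_add_I simp_thms)
qed

text \<open>With D the diagonal matrix of \<open>f\<close>, this map is the congruence sending A to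
  D* A D: its quadratic form at \<open>v\<close> is that of \<open>A\<close> at D v.\<close>

lemma psd_schur_map_rank_one:
  assumes "psd A"
  shows "psd (schur_map (\<lambda>i j. cnj (f i) * f j) A)"
proof -
  have "(\<Sum>i\<in>UNIV. cnj (v $ i) * (schur_map (\<lambda>i j. cnj (f i) * f j) A *v v) $ i) =
        (\<Sum>i\<in>UNIV. cnj ((\<chi> k. f k * v $ k) $ i) * (A *v (\<chi> k. f k * v $ k)) $ i)" for v
    by (simp add: matrix_vector_mult_def sum_distrib_left ac_simps)
  moreover have "hermitian (schur_map (\<lambda>i j. cnj (f i) * f j) A)"
    unfolding hermitian_def
  proof (intro allI)
    fix i j
    have "A $ i $ j = cnj (A $ j $ i)" using assms unfolding psd_def hermitian_def by blast
    then show "schur_map (\<lambda>i j. cnj (f i) * f j) A $ i $ j =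
        cnj (schur_map (\<lambda>i j. cnj (f i) * f j) A $ j $ i)"
      by simp
  qed
  ultimately show ?thesis using assms by (simp only: psd_def simp_thms)
qed

text \<open>The extended map is again a Schur multiplication, by the same factors read off the
  second components of the indices, hence a sum of two congruences.\<close>

lemma two_positive_schur_map_gram:
  fixes f g :: "'n::finite \<Rightarrow> complex"
  shows "two_positive (schur_map (\<lambda>i j. cnj (f i) * f j + cnj (g i) * g j))"
proof -
  have "id_tensor (schur_map (\<lambda>i j. cnj (f i) * f j + cnj (g i) * g j)) X =
    schur_map (\<lambda>p q. cnj (f (snd p)) * f (snd q)) X +
    schur_map (\<lambda>p q. cnj (g (snd p)) * g (snd q)) X" for X :: "complex^(2 \<times> 'n)^(2 \<times> 'n)"
    by (simp add: vec_eq_iff id_tensor_def block_def distrib_right)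
  then show ?thesis
    by (simp add: two_positive_def positive_map_def psd_add psd_schur_map_rank_one)
qed

theorem mainTheorem3:
  fixes c :: real
  assumes "CARD('n::finite) \<ge> 2"
    and "c > real CARD('n)"
  shows "\<exists>\<Phi> :: complex^'n^'n \<Rightarrow> complex^'n^'n.
           clinear \<Phi> \<and> two_positive \<Phi> \<and> trace_preserving \<Phi> \<and>
           Re (op_trace \<Phi>) > c * min_Re_spectrum \<Phi> + ((real CARD('n))\<^sup>2 - c)"
proof -
  define d where "d = real CARD('n)"
  have d: "d \<ge> 2" "c > d" using assms by (auto simp: d_def)
  \<comment> \<open>With x = cos \<theta> = 1 - t, the gap between the two sides is t (4 (c - d) + t
    (4 - 2 c)), positive for small t > 0. Taking t = 1 - d / c gives c - d = c t and turns the gap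
    into 2 t^2 (c + 2).\<close>
  define x where "x = d / c"
  define y where "y = sqrt (1 - x\<^sup>2)"
  have x: "0 < x" "x < 1" using d by (auto simp: x_def)
  then have "x\<^sup>2 \<le> 1" by (simp add: power_le_one)
  then have y: "y * y = 1 - x * x" by (simp add: y_def flip: power2_eq_square)
  obtain p q :: 'n where pq: "p \<noteq> q"
    using assms(1) card_le_Suc0_iff_eq[of "UNIV :: 'n set"] by fastforce
  define a where "a i = (if i = p \<or> i = q then x else 1)" for i
  \<comment> \<open>The opposite signs make the sum of \<open>b\<close> vanish and lower the entry
    \<open>m p q\<close> to x^2 - y^2 = 2 x^2 - 1.\<close>
  define b where "b i = (if i = p then y else if i = q then - y else 0)" for i
  define m where "m i j = cnj (complex_of_real (a i)) * complex_of_real (a j)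
    + cnj (complex_of_real (b i)) * complex_of_real (b j)" for i j
  have m: "m i j = complex_of_real (a i * a j + b i * b j)" for i j by (simp add: m_def)
  have "a i * a i + b i * b i = 1" for i using y by (simp add: a_def b_def)
  then have tp: "trace_preserving (schur_map m)"
    by (intro trace_preserving_schur_map) (simp only: m of_real_1)
  have "two_positive (schur_map m)"
    unfolding m_def by (rule two_positive_schur_map_gram)
  moreover have "Re (op_trace (schur_map m)) > c * min_Re_spectrum (schur_map m) + (d\<^sup>2 - c)"
  proof -
    have "a i = 1 + (if i = p then x - 1 else 0) + (if i = q then x - 1 else 0)" for i
      using pq by (auto simp: a_def)
    then have suma: "(\<Sum>i\<in>UNIV. a i) = d + 2 * (x - 1)"
      by (simp add: sum.distrib d_def)
    have "b i = (if i = p then y else 0) + (if i = q then - y else 0)" for i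
      using pq by (auto simp: b_def)
    then have sumb: "(\<Sum>i\<in>UNIV. b i) = 0" by (simp add: sum.distrib)
    \<comment> \<open>The double sum of each product a_i a_j or b_i b_j factors into a
      square.\<close>
    have "Re (op_trace (schur_map m)) = (\<Sum>i\<in>UNIV. a i)\<^sup>2 + (\<Sum>i\<in>UNIV. b i)\<^sup>2"
      by (simp add: op_trace_schur_map m sum.distrib power2_eq_square sum_product)
    then have tr: "Re (op_trace (schur_map m)) = (d + 2 * (x - 1))\<^sup>2"
      by (simp add: suma sumb)
    have "Re (m p q) = 2 * x\<^sup>2 - 1"
      using pq y by (simp add: m a_def b_def power2_eq_square)
    then have "min_Re_spectrum (schur_map m) \<le> 2 * x\<^sup>2 - 1"
      using min_Re_spectrum_schur_map_le by metis
    then have "c * min_Re_spectrum (schur_map m) \<le> c * (2 * x\<^sup>2 - 1)"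
      using d by (intro mult_left_mono) auto
    moreover have "c * (2 * x\<^sup>2 - 1) + (d\<^sup>2 - c) < (d + 2 * (x - 1))\<^sup>2"
    proof -
      \<comment> \<open>Eliminating \<open>d\<close> reduces the gap to a polynomial identity in
        \<open>c\<close> and \<open>x\<close>.\<close>
      have "d = c * x" using d by (simp add: x_def)
      then have "(d + 2 * (x - 1))\<^sup>2 - (c * (2 * x\<^sup>2 - 1) + (d\<^sup>2 - c))
          = 2 * (1 - x)\<^sup>2 * (c + 2)"
        by (simp add: power2_eq_square algebra_simps)
      moreover have "2 * (1 - x)\<^sup>2 * (c + 2) > 0" using x d by simp
      ultimately show ?thesis by linarith
    qed
    ultimately show ?thesis unfolding tr by linarith
  qed
  ultimately show ?thesis
    using clinear_schur_map tp unfolding d_def by blast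
qed

end
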